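(* Every $n$-qubit CNOT circuit of depth $d$ can be synthesised (up to global phase) by a circuit on $n$ qubits consisting of local Clifford gates and at most $d\,2^k$ untargeted $n$-qubit $\mathrm{GZZ}(\frac{\pi}{2^{k+1}})$ gates, where $k\in\mathbb{N}$ is the smallest number such that $n-1\leq 2^k$.
   Context: $\mathbb{N}=\{0,1,2,\dots\}$. For a set $Q$ of qubits and a real $\alpha$, $\mathrm{GZZ}_Q(\alpha)=\prod_{i<j\in Q}\exp(-i\frac{\alpha}{2}Z_iZ_j)$, where $Z_i$ is the Pauli $Z$ on qubit $i$. An untargeted $n$-qubit $\mathrm{GZZ}(\alpha)$ gate is $\mathrm{GZZ}_Q(\alpha)$ with $Q$ the set of all $n$ qubits of the circuit. A CNOT circuit is a circuit consisting only of CNOT gates; it has depth $d$ if it is a sequence of $d$ layers, each layer consisting of CNOT gates acting on pairwise disjoint pairs of qubits. A local Clifford gate is a single-qubit Clifford unitary; any number of these may be used. *)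

theory Defs
  imports "Jordan_Normal_Form.Schur_Decomposition" Complex_Main
begin

text \<open>
  The qubits of an \<open>n\<close>-qubit register are \<open>0, \<dots>, n - 1\<close>. Operators are complex
  \<open>2 ^ n \<times> 2 ^ n\<close> matrices; the basis index \<open>r < 2 ^ n\<close> stands for the computational basis
  state in which qubit \<open>q\<close> has the value \<open>bit r q\<close>.
\<close>

definition pauli_X :: "complex mat" where
  "pauli_X = mat_of_rows_list 2 [[0, 1], [1, 0]]"

definition pauli_Y :: "complex mat" where
  "pauli_Y = mat_of_rows_list 2 [[0, - \<i>], [\<i>, 0]]"

definition pauli_Z :: "complex mat" where
  "pauli_Z = mat_of_rows_list 2 [[1, 0], [0, - 1]]"

definition pauli_group :: "complex mat set" where
  "pauli_group =
    {c \<cdot>\<^sub>m P | c P. c \<in> {1, - 1, \<i>, - \<i>} \<and> P \<in> {1\<^sub>m 2, pauli_X, pauli_Y, pauli_Z}}"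

definition unitary_mat :: "nat \<Rightarrow> complex mat \<Rightarrow> bool" where
  "unitary_mat m U \<longleftrightarrow>
    U \<in> carrier_mat m m \<and> U * mat_adjoint U = 1\<^sub>m m \<and> mat_adjoint U * U = 1\<^sub>m m"

definition local_clifford :: "complex mat \<Rightarrow> bool" where
  "local_clifford U \<longleftrightarrow>
    unitary_mat 2 U \<and> (\<forall>P\<in>pauli_group. U * P * mat_adjoint U \<in> pauli_group)"

text \<open>The matrix exponential, as the entrywise limit of the (always convergent) power series.\<close>

definition mat_exp :: "complex mat \<Rightarrow> complex mat" where
  "mat_exp A = mat (dim_row A) (dim_col A) (\<lambda>(i, j). \<Sum>m. (A ^\<^sub>m m) $$ (i, j) / fact m)"

text \<open>\<open>I \<otimes> \<dots> \<otimes> U \<otimes> \<dots> \<otimes> I\<close> with the \<open>2 \<times> 2\<close> matrix \<open>U\<close> acting on qubit \<open>q\<close>.\<close>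

definition on_qubit :: "nat \<Rightarrow> nat \<Rightarrow> complex mat \<Rightarrow> complex mat" where
  "on_qubit n q U = mat (2 ^ n) (2 ^ n) (\<lambda>(r, c).
    if \<forall>p<n. p \<noteq> q \<longrightarrow> bit r p = bit c p
    then U $$ (of_bool (bit r q), of_bool (bit c q)) else 0)"

definition cnot_mat :: "nat \<Rightarrow> nat \<Rightarrow> nat \<Rightarrow> complex mat" where
  "cnot_mat n ctl tgt = mat (2 ^ n) (2 ^ n) (\<lambda>(r, c).
    if r = (if bit c ctl then flip_bit tgt c else c) then 1 else 0)"

text \<open>
  The product over all \<open>i < j\<close> in \<open>Q\<close> is taken in list order; the order is immaterial because
  the factors, being diagonal, commute.
\<close>

definition gzz_mat :: "nat \<Rightarrow> nat set \<Rightarrow> real \<Rightarrow> complex mat" where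
  "gzz_mat n Q \<alpha> =
    foldr (\<lambda>(i, j) M.
        mat_exp ((- \<i> * of_real (\<alpha> / 2)) \<cdot>\<^sub>m (on_qubit n i pauli_Z * on_qubit n j pauli_Z)) * M)
      (filter (\<lambda>(i, j). i < j) (List.product (sorted_list_of_set Q) (sorted_list_of_set Q)))
      (1\<^sub>m (2 ^ n))"

text \<open>
  \<open>CNOT c t\<close> has control \<open>c\<close> and target \<open>t\<close>. A circuit is a list of gates, the head being
  applied first.
\<close>

datatype gate = CNOT nat nat | Local nat "complex mat" | GZZ "nat set" real

type_synonym circuit = "gate list"

fun gate_mat :: "nat \<Rightarrow> gate \<Rightarrow> complex mat" where
  "gate_mat n (CNOT c t) = cnot_mat n c t"
| "gate_mat n (Local q U) = on_qubit n q U"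
| "gate_mat n (GZZ Q \<alpha>) = gzz_mat n Q \<alpha>"

fun circuit_mat :: "nat \<Rightarrow> circuit \<Rightarrow> complex mat" where
  "circuit_mat n [] = 1\<^sub>m (2 ^ n)"
| "circuit_mat n (g # gs) = circuit_mat n gs * gate_mat n g"

fun gate_qubits :: "gate \<Rightarrow> nat set" where
  "gate_qubits (CNOT c t) = {c, t}"
| "gate_qubits (Local q U) = {q}"
| "gate_qubits (GZZ Q \<alpha>) = Q"

definition cnot_layer :: "nat \<Rightarrow> gate list \<Rightarrow> bool" where
  "cnot_layer n L \<longleftrightarrow>
    (\<forall>g\<in>set L. \<exists>c t. g = CNOT c t \<and> c < n \<and> t < n \<and> c \<noteq> t) \<and>
    (\<forall>i<length L. \<forall>j<length L. i \<noteq> j \<longrightarrow> gate_qubits (L ! i) \<inter> gate_qubits (L ! j) = {})"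

definition cnot_circuit :: "nat \<Rightarrow> nat \<Rightarrow> circuit \<Rightarrow> bool" where
  "cnot_circuit n d C \<longleftrightarrow>
    (\<exists>Ls. length Ls = d \<and> (\<forall>L\<in>set Ls. cnot_layer n L) \<and> C = concat Ls)"

definition local_clifford_gate :: "nat \<Rightarrow> gate \<Rightarrow> bool" where
  "local_clifford_gate n g \<longleftrightarrow> (\<exists>q U. g = Local q U \<and> q < n \<and> local_clifford U)"

definition untargeted_gzz :: "nat \<Rightarrow> real \<Rightarrow> gate" where
  "untargeted_gzz n \<alpha> = GZZ {..<n} \<alpha>"

definition synthesises :: "nat \<Rightarrow> circuit \<Rightarrow> circuit \<Rightarrow> bool" where
  "synthesises n C' C \<longleftrightarrow> (\<exists>\<theta>::real. circuit_mat n C' = cis \<theta> \<cdot>\<^sub>m circuit_mat n C)"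

end

theory Submission
  imports Defs
begin

text \<open>
  With \<open>S\<^sup>\<dagger> = diag(1, -i)\<close> one has \<open>CZ = e\<^bsup>i\<pi>/4\<^esup> (S\<^sup>\<dagger> \<otimes> S\<^sup>\<dagger>) exp(-i (\<pi>/4) Z Z)\<close>, and a CNOT is a CZ
  conjugated by a Hadamard on the target; so up to local Cliffords a layer is the product of
  \<open>exp(-i (\<pi>/4) Z\<^sub>c Z\<^sub>t)\<close> over its pairs. Conjugating \<open>GZZ(\<alpha>)\<close> by \<open>X\<close> on the qubits with sign
  \<open>x\<^sub>q = -1\<close> turns \<open>Z\<^sub>i Z\<^sub>j\<close> into \<open>x\<^sub>i x\<^sub>j Z\<^sub>i Z\<^sub>j\<close>. Attach to each qubit a row of the Sylvester-Hadamard
  matrix of order \<open>2 ^ k\<close>, the same row to paired qubits and distinct rows otherwise, and take in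
  round \<open>b\<close> the signs in column \<open>b\<close>: over the \<open>2 ^ k\<close> rounds unpaired interactions cancel by
  orthogonality and paired ones add up to the angle \<open>\<pi>/2\<close>. A nonempty layer needs at most \<open>n - 1\<close> rows.
\<close>

section \<open>Bits of basis-state indices\<close>

lemma less_exp_iff_bit:
  "(r::nat) < 2 ^ n \<longleftrightarrow> (\<forall>p\<ge>n. \<not> bit r p)"
proof
  assume "r < 2 ^ n"
  then have "take_bit n r = r" by (simp add: take_bit_nat_eq_self_iff)
  then show "\<forall>p\<ge>n. \<not> bit r p" by (metis bit_take_bit_iff linorder_not_le)
next
  assume "\<forall>p\<ge>n. \<not> bit r p"
  then have "take_bit n r = r" by (intro bit_eqI) (auto simp: bit_take_bit_iff not_le[symmetric])
  then show "r < 2 ^ n" by (simp add: take_bit_nat_eq_self_iff)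
qed

lemma nat_eq_iff_bits:
  assumes "(r::nat) < 2 ^ n" "s < 2 ^ n"
  shows "r = s \<longleftrightarrow> (\<forall>p<n. bit r p = bit s p)"
proof
  assume a: "\<forall>p<n. bit r p = bit s p"
  show "r = s"
    by (rule bit_eqI, rename_tac p, case_tac "p < n") (use a assms in \<open>auto simp: less_exp_iff_bit\<close>)
qed simp

lemma bit_flip_nat [simp]: "bit (flip_bit q (r::nat)) p \<longleftrightarrow> (if p = q then \<not> bit r p else bit r p)"
  by (auto simp: bit_flip_bit_iff)

lemma bit_set_nat [simp]: "bit (set_bit q (r::nat)) p \<longleftrightarrow> p = q \<or> bit r p"
  by (auto simp: bit_set_bit_iff)

lemma bit_unset_nat [simp]: "bit (unset_bit q (r::nat)) p \<longleftrightarrow> p \<noteq> q \<and> bit r p"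
  by (auto simp: bit_unset_bit_iff)

lemma bit_ops_less [simp]:
  assumes "(r::nat) < 2 ^ n" "q < n"
  shows "flip_bit q r < 2 ^ n" "set_bit q r < 2 ^ n" "unset_bit q r < 2 ^ n"
  using assms by (auto simp: less_exp_iff_bit)

section \<open>Entries and commutation of single-qubit operators\<close>

lemma on_qubit_carrier [simp]: "on_qubit n q U \<in> carrier_mat (2 ^ n) (2 ^ n)"
  by (simp add: on_qubit_def)

lemma on_qubit_dim [simp]:
  "dim_row (on_qubit n q U) = 2 ^ n" "dim_col (on_qubit n q U) = 2 ^ n"
  by (simp_all add: on_qubit_def)

lemma on_qubit_index:
  assumes "r < 2 ^ n" "c < 2 ^ n"
  shows "on_qubit n q U $$ (r, c) =
    (if \<forall>p<n. p \<noteq> q \<longrightarrow> bit r p = bit c p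
     then U $$ (of_bool (bit r q), of_bool (bit c q)) else 0)"
  using assms by (simp add: on_qubit_def)

text \<open>Row \<open>r\<close> of \<open>on_qubit n q U\<close> is supported on the two indices
  that agree with \<open>r\<close> away from \<open>q\<close>, so only two terms of the matrix
  product survive.\<close>

lemma on_qubit_mult_index:
  assumes q: "q < n" and M: "M \<in> carrier_mat (2 ^ n) (2 ^ n)" and r: "r < 2 ^ n" and c: "c < 2 ^ n"
  shows "(on_qubit n q U * M) $$ (r, c) =
    U $$ (of_bool (bit r q), 0) * M $$ (unset_bit q r, c) +
    U $$ (of_bool (bit r q), 1) * M $$ (set_bit q r, c)"
proof -
  let ?f = "\<lambda>s. on_qubit n q U $$ (r, s) * M $$ (s, c)"
  have ne: "unset_bit q r \<noteq> set_bit q r"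
  proof
    assume "unset_bit q r = set_bit q r"
    then have "bit (unset_bit q r) q = bit (set_bit q r) q" by simp
    then show False by simp
  qed
  have z: "?f s = 0" if s: "s < 2 ^ n" "s \<noteq> unset_bit q r" "s \<noteq> set_bit q r" for s
  proof -
    have "\<not> (\<forall>p<n. p \<noteq> q \<longrightarrow> bit r p = bit s p)"
    proof
      assume a: "\<forall>p<n. p \<noteq> q \<longrightarrow> bit r p = bit s p"
      \<comment> \<open>The bit of \<open>s\<close> at \<open>q\<close> decides which of the two
        candidates it has to be.\<close>
      have "s = (if bit s q then set_bit q r else unset_bit q r)"
        using a s r q by (subst nat_eq_iff_bits[of _ n]) auto
      then show False using s by presburger
    qed
    then show ?thesis by (simp only: on_qubit_index[OF r s(1)] if_False mult_zero_left)
  qed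
  have "(on_qubit n q U * M) $$ (r, c) = (\<Sum>s<2 ^ n. ?f s)"
    using M r c by (simp add: scalar_prod_def atLeast0LessThan)
  also have "\<dots> = (\<Sum>s\<in>{unset_bit q r, set_bit q r}. ?f s)"
    by (rule sum.mono_neutral_right) (use z r q in auto)
  also have "\<dots> = ?f (unset_bit q r) + ?f (set_bit q r)"
    using ne by simp
  finally show ?thesis using r q by (simp add: on_qubit_index)
qed

text \<open>Used for commutation: the right-hand side is symmetric in \<open>(p, U)\<close> and
  \<open>(q, V)\<close>.\<close>

lemma on_qubit_mult_on_qubit_index:
  assumes pq: "p < n" "q < n" "p \<noteq> q" and rc: "r < 2 ^ n" "c < 2 ^ n"
  shows "(on_qubit n p U * on_qubit n q V) $$ (r, c) =
    (if \<forall>s<n. s \<noteq> p \<longrightarrow> s \<noteq> q \<longrightarrow> bit r s = bit c s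
     then U $$ (of_bool (bit r p), of_bool (bit c p)) * V $$ (of_bool (bit r q), of_bool (bit c q))
     else 0)"
proof -
  define Q where "Q \<longleftrightarrow> (\<forall>s<n. s \<noteq> p \<longrightarrow> s \<noteq> q \<longrightarrow> bit r s = bit c s)"
  \<comment> \<open>Only the intermediate index whose bit at \<open>p\<close> is that of
    \<open>c\<close> contributes; by \<open>u\<close> and \<open>s\<close> the other of the two
    terms vanishes.\<close>
  have u: "(\<forall>s<n. s \<noteq> q \<longrightarrow> bit (unset_bit p r) s = bit c s) \<longleftrightarrow> \<not> bit c p \<and> Q"
    using pq unfolding Q_def by (simp only: bit_unset_nat) metis
  have s: "(\<forall>s<n. s \<noteq> q \<longrightarrow> bit (set_bit p r) s = bit c s) \<longleftrightarrow> bit c p \<and> Q"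
    using pq unfolding Q_def by (simp only: bit_set_nat) metis
  have b: "bit (unset_bit p r) q = bit r q" "bit (set_bit p r) q = bit r q"
    using pq by auto
  have l: "unset_bit p r < 2 ^ n" "set_bit p r < 2 ^ n" using pq rc by simp_all
  show ?thesis
    unfolding on_qubit_mult_index[OF pq(1) on_qubit_carrier rc]
      on_qubit_index[OF l(1) rc(2)] on_qubit_index[OF l(2) rc(2)] u s b Q_def[symmetric]
    by simp
qed

lemma on_qubit_commute:
  assumes "p < n" "q < n" "p \<noteq> q"
  shows "on_qubit n p U * on_qubit n q V = on_qubit n q V * on_qubit n p U"
proof (rule eq_matI)
  fix r c
  assume "r < dim_row (on_qubit n q V * on_qubit n p U)" "c < dim_col (on_qubit n q V * on_qubit n p U)"
  then have rc: "r < 2 ^ n" "c < 2 ^ n" by simp_all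
  show "(on_qubit n p U * on_qubit n q V) $$ (r, c) = (on_qubit n q V * on_qubit n p U) $$ (r, c)"
    unfolding on_qubit_mult_on_qubit_index[OF assms rc]
      on_qubit_mult_on_qubit_index[OF assms(2,1) assms(3)[symmetric] rc]
    by (auto simp: mult.commute)
qed simp_all

text \<open>\<open>on_qubit n q U\<close> only connects basis states that agree away from
  \<open>q\<close>, and on such states \<open>f\<close> takes equal values.\<close>

lemma on_qubit_commute_diag:
  assumes "\<And>r c. r < 2 ^ n \<Longrightarrow> c < 2 ^ n \<Longrightarrow> \<forall>p<n. p \<noteq> q \<longrightarrow> bit r p = bit c p \<Longrightarrow> f r = f c"
  shows "on_qubit n q U * mat_diag (2 ^ n) f = mat_diag (2 ^ n) f * on_qubit n q U"
proof -
  have "on_qubit n q U $$ (r, c) * f c = f r * on_qubit n q U $$ (r, c)"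
    if rc: "r < 2 ^ n" "c < 2 ^ n" for r c
  proof (cases "\<forall>p<n. p \<noteq> q \<longrightarrow> bit r p = bit c p")
    case True
    show ?thesis by (simp only: assms[OF rc True] mult.commute)
  next
    case False
    show ?thesis by (simp only: on_qubit_index[OF rc] False if_False mult_zero_left mult_zero_right)
  qed
  then show ?thesis
    unfolding mat_diag_mult_left[OF on_qubit_carrier] mat_diag_mult_right[OF on_qubit_carrier]
    by (intro cong_mat) simp_all
qed

section \<open>Diagonal matrices and the diagonal form of GZZ\<close>

lemma mat_diag_cong: "(\<And>i. i < n \<Longrightarrow> f i = g i) \<Longrightarrow> mat_diag n f = mat_diag n g"
  by (intro eq_matI) (auto simp: mat_diag_def)

lemma mat_diag_pow:
  fixes f :: "nat \<Rightarrow> 'a :: comm_semiring_1"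
  shows "mat_diag n f ^\<^sub>m m = mat_diag n (\<lambda>i. f i ^ m)"
proof (induction m)
  case 0
  have "dim_row (mat_diag n f) = n" by (simp add: mat_diag_def)
  then show ?case by simp
next
  case (Suc m)
  then show ?case by (simp add: mult.commute)
qed

text \<open>Powers of a diagonal matrix are diagonal, so the defining series is the scalar
  exponential series on the diagonal and zero elsewhere.\<close>

lemma mat_exp_diag:
  "mat_exp (mat_diag n f) = mat_diag n (\<lambda>i. exp (f i))"
proof -
  have "(\<Sum>m. (mat_diag n f ^\<^sub>m m) $$ (i, j) / fact m) = (if i = j then exp (f j) else 0)"
    if "i < n" "j < n" for i j
    using that unfolding mat_diag_pow
    by (simp add: mat_diag_def exp_def scaleR_conv_of_real divide_inverse mult.commute)
  then show ?thesis by (intro eq_matI) (auto simp: mat_exp_def mat_diag_def)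
qed

lemma smult_mat_diag:
  fixes a :: "'a :: semiring_0"
  shows "a \<cdot>\<^sub>m mat_diag n f = mat_diag n (\<lambda>i. a * f i)"
  by (intro eq_matI) (auto simp: mat_diag_def)

lemma on_qubit_diag:
  "on_qubit n q (mat_of_rows_list 2 [[a, 0], [0, b]]) =
    mat_diag (2 ^ n) (\<lambda>r. if bit r q then b else a)"
  if "q < n"
proof (rule eq_matI)
  let ?D = "mat_diag (2 ^ n) (\<lambda>r. if bit r q then b else a)"
  fix r c
  assume "r < dim_row ?D" "c < dim_col ?D"
  then have rc: "r < 2 ^ n" "c < 2 ^ n" by (simp_all add: mat_diag_def)
  show "on_qubit n q (mat_of_rows_list 2 [[a, 0], [0, b]]) $$ (r, c) = ?D $$ (r, c)"
    using rc that nat_eq_iff_bits[OF rc]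
    by (auto simp: on_qubit_index mat_diag_def mat_of_rows_list_def)
qed (simp_all add: mat_diag_def)

text \<open>The eigenvalue of \<open>Z\<close> on qubit \<open>q\<close> at the basis state
  \<open>r\<close>.\<close>

definition zval :: "nat \<Rightarrow> nat \<Rightarrow> real" where
  "zval r q = (if bit r q then - 1 else 1)"

lemma on_qubit_Z: "q < n \<Longrightarrow> on_qubit n q pauli_Z = mat_diag (2 ^ n) (\<lambda>r. of_real (zval r q))"
  unfolding pauli_Z_def by (subst on_qubit_diag) (auto intro!: mat_diag_cong simp: zval_def)

text \<open>All factors are diagonal, so the product of exponentials becomes a sum of
  \<open>Z\<close> eigenvalue products in the exponent.\<close>

lemma gzz_mat_diag:
  "gzz_mat n {..<n} \<alpha> = mat_diag (2 ^ n) (\<lambda>r.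
    exp (- \<i> * of_real (\<alpha> / 2 * (\<Sum>(i, j)\<in>{(i, j). i < j \<and> j < n}. zval r i * zval r j))))"
proof -
  define xs where "xs = filter (\<lambda>(i, j). i < j) (List.product [0..<n] [0..<n])"
  have set_xs: "set xs = {(i, j). i < j \<and> j < n}" and "distinct xs"
    by (auto simp: xs_def distinct_product)
  \<comment> \<open>Generalised to any list of admissible pairs for the induction; the inclusion
    supplies the bounds that \<open>on_qubit_Z\<close> requires.\<close>
  have "foldr (\<lambda>(i, j) M.
        mat_exp ((- \<i> * of_real (\<alpha> / 2)) \<cdot>\<^sub>m (on_qubit n i pauli_Z * on_qubit n j pauli_Z)) * M)
      ys (1\<^sub>m (2 ^ n)) = mat_diag (2 ^ n) (\<lambda>r.
        exp (- \<i> * of_real (\<alpha> / 2 * (\<Sum>(i, j)\<leftarrow>ys. zval r i * zval r j))))"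
    if "set ys \<subseteq> {(i, j). i < j \<and> j < n}" for ys
    using that
    by (induction ys) (auto simp: on_qubit_Z smult_mat_diag mat_exp_diag exp_add[symmetric]
        algebra_simps simp flip: exp_minus intro!: mat_diag_cong)
  from this[of xs] show ?thesis
    unfolding gzz_mat_def lessThan_atLeast0 sorted_list_of_set_range xs_def[symmetric]
    by (simp only: set_xs order_refl sum_list_distinct_conv_sum_set[OF \<open>distinct xs\<close>])
qed

section \<open>Two-by-two matrices and the Clifford property\<close>

abbreviation mat2 :: "complex \<Rightarrow> complex \<Rightarrow> complex \<Rightarrow> complex \<Rightarrow> complex mat" where
  "mat2 a b c d \<equiv> mat_of_rows_list 2 [[a, b], [c, d]]"

lemma mat2_index [simp]:
  "mat2 a b c d $$ (0, 0) = a" "mat2 a b c d $$ (0, Suc 0) = b"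
  "mat2 a b c d $$ (Suc 0, 0) = c" "mat2 a b c d $$ (Suc 0, Suc 0) = d"
  by (simp_all add: mat_of_rows_list_def)

lemma mat2_carrier [simp]: "mat2 a b c d \<in> carrier_mat 2 2"
  by (rule carrier_matI) (simp_all add: mat_of_rows_list_def)

lemma mat2_dim [simp]: "dim_row (mat2 a b c d) = 2" "dim_col (mat2 a b c d) = 2"
  by (simp_all add: mat_of_rows_list_def)

lemma mat2_eqI:
  assumes "A \<in> carrier_mat 2 2" "A $$ (0, 0) = a" "A $$ (0, 1) = b" "A $$ (1, 0) = c" "A $$ (1, 1) = d"
  shows "A = mat2 a b c d"
  using assms by (intro eq_matI) (auto simp: less_2_cases_iff)

lemma sum_lessThan_2: "sum f {0..<2::nat} = f 0 + f 1"
  by (simp add: numeral_2_eq_2)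

lemma mat2_mult:
  "mat2 a b c d * mat2 a' b' c' d' =
    mat2 (a * a' + b * c') (a * b' + b * d') (c * a' + d * c') (c * b' + d * d')"
  by (rule mat2_eqI, rule mult_carrier_mat[OF mat2_carrier mat2_carrier])
    (simp_all add: scalar_prod_def sum_lessThan_2)

lemma mat2_smult: "k \<cdot>\<^sub>m mat2 a b c d = mat2 (k * a) (k * b) (k * c) (k * d)"
  by (rule mat2_eqI) simp_all

lemma mat2_one: "1\<^sub>m 2 = mat2 1 0 0 1"
  by (rule mat2_eqI) simp_all

lemma mat2_adjoint: "mat_adjoint (mat2 a b c d) = mat2 (cnj a) (cnj c) (cnj b) (cnj d)"
  by (rule mat2_eqI) (auto simp: mat_adjoint_def mat_of_rows_def cols_def upt_rec)

lemmas pauli_mat2 = pauli_X_def pauli_Y_def pauli_Z_def mat2_one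

text \<open>Conjugation is linear, the four scalars are closed under multiplication, and unitarity
  fixes the identity; this leaves the three nontrivial Paulis to check.\<close>

lemma local_cliffordI:
  assumes U: "unitary_mat 2 U"
    and P: "\<And>P. P \<in> {pauli_X, pauli_Y, pauli_Z} \<Longrightarrow> U * P * mat_adjoint U \<in> pauli_group"
  shows "local_clifford U"
  unfolding local_clifford_def
proof (intro conjI ballI)
  fix R assume "R \<in> pauli_group"
  then obtain c P where c: "c \<in> {1, - 1, \<i>, - \<i>}"
    and PP: "P \<in> {1\<^sub>m 2, pauli_X, pauli_Y, pauli_Z}" and R: "R = c \<cdot>\<^sub>m P"
    unfolding pauli_group_def by blast
  have UC: "U \<in> carrier_mat 2 2" "mat_adjoint U \<in> carrier_mat 2 2"
    using U by (auto simp: unitary_mat_def mat_adjoint_def)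
  have PC: "P \<in> carrier_mat 2 2" using PP by (auto simp: pauli_mat2)
  have "1\<^sub>m 2 = 1 \<cdot>\<^sub>m (1\<^sub>m 2 :: complex mat)" by (intro eq_matI) auto
  then have one: "1\<^sub>m 2 \<in> pauli_group" unfolding pauli_group_def by blast
  have "U * 1\<^sub>m 2 * mat_adjoint U = 1\<^sub>m 2" using U UC by (simp add: unitary_mat_def)
  then have "U * P * mat_adjoint U \<in> pauli_group" using PP P one by auto
  then obtain c' P' where c': "c' \<in> {1, - 1, \<i>, - \<i>}"
    and P': "P' \<in> {1\<^sub>m 2, pauli_X, pauli_Y, pauli_Z}" and eq: "U * P * mat_adjoint U = c' \<cdot>\<^sub>m P'"
    unfolding pauli_group_def by blast
  have "U * R * mat_adjoint U = c \<cdot>\<^sub>m (U * P * mat_adjoint U)"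
    unfolding R using UC PC
    by (simp add: mult_smult_distrib[of _ 2 2 _ 2] mult_smult_assoc_mat[of _ 2 2 _ 2])
  also have "\<dots> = (c * c') \<cdot>\<^sub>m P'" unfolding eq by (intro eq_matI) (auto simp: mult.assoc)
  finally show "U * R * mat_adjoint U \<in> pauli_group"
    using c c' P' unfolding pauli_group_def by fastforce
qed (rule U)

lemma pauli_groupI:
  "c \<in> {1, - 1, \<i>, - \<i>} \<Longrightarrow> P \<in> {pauli_X, pauli_Y, pauli_Z} \<Longrightarrow> A = c \<cdot>\<^sub>m P \<Longrightarrow> A \<in> pauli_group"
  unfolding pauli_group_def by blast

definition hadamard :: "complex mat" where
  "hadamard = (let s = of_real (1 / sqrt 2) in mat2 s s s (- s))"

definition sdg :: "complex mat" where
  "sdg = mat2 1 0 0 (- \<i>)"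

lemma sqrt_half: "complex_of_real (1 / sqrt 2) * complex_of_real (1 / sqrt 2) = 1 / 2"
  unfolding of_real_mult[symmetric] by simp

text \<open>Conjugation exchanges \<open>X\<close> and \<open>Z\<close> and sends \<open>Y\<close>
  to \<open>-Y\<close>.\<close>

lemma local_clifford_hadamard: "local_clifford hadamard"
proof (rule local_cliffordI)
  define s where "s = complex_of_real (1 / sqrt 2)"
  have s: "cnj s = s" "s * s = 1 / 2" unfolding s_def by (simp, rule sqrt_half)
  have h: "hadamard = mat2 s s s (- s)" by (simp add: hadamard_def Let_def s_def)
  show "unitary_mat 2 hadamard"
    by (simp add: unitary_mat_def h mat2_adjoint mat2_mult s mat2_one)
  fix P assume "P \<in> {pauli_X, pauli_Y, pauli_Z}"
  then consider "P = pauli_X" | "P = pauli_Y" | "P = pauli_Z" by blast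
  then show "hadamard * P * mat_adjoint hadamard \<in> pauli_group"
  proof cases
    case 1
    show ?thesis unfolding 1
      by (rule pauli_groupI[of 1 pauli_Z]) (simp_all add: h pauli_mat2 mat2_adjoint mat2_mult mat2_smult s)
  next
    case 2
    show ?thesis unfolding 2
      by (rule pauli_groupI[of "- 1" pauli_Y])
        (simp_all add: h pauli_mat2 mat2_adjoint mat2_mult mat2_smult s mult.assoc)
  next
    case 3
    show ?thesis unfolding 3
      by (rule pauli_groupI[of 1 pauli_X]) (simp_all add: h pauli_mat2 mat2_adjoint mat2_mult mat2_smult s)
  qed
qed

lemma local_clifford_X: "local_clifford pauli_X"
proof (rule local_cliffordI)
  show "unitary_mat 2 pauli_X"
    by (simp add: unitary_mat_def pauli_mat2 mat2_adjoint mat2_mult)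
  fix P assume "P \<in> {pauli_X, pauli_Y, pauli_Z}"
  \<comment> \<open>\<open>X\<close> commutes with itself and anticommutes with \<open>Y\<close> and
    \<open>Z\<close>.\<close>
  then have "pauli_X * P * mat_adjoint pauli_X = (if P = pauli_X then 1 else - 1) \<cdot>\<^sub>m P"
    by (auto simp: pauli_mat2 mat2_adjoint mat2_mult mat2_smult)
  then show "pauli_X * P * mat_adjoint pauli_X \<in> pauli_group"
    using \<open>P \<in> _\<close> by (intro pauli_groupI) auto
qed

text \<open>Conjugation sends \<open>X\<close> to \<open>-Y\<close> and \<open>Y\<close> to
  \<open>X\<close>, and fixes \<open>Z\<close>.\<close>

lemma local_clifford_sdg: "local_clifford sdg"
proof (rule local_cliffordI)
  show "unitary_mat 2 sdg"
    by (simp add: unitary_mat_def sdg_def mat2_one mat2_adjoint mat2_mult)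
  fix P assume "P \<in> {pauli_X, pauli_Y, pauli_Z}"
  then consider "P = pauli_X" | "P = pauli_Y" | "P = pauli_Z" by blast
  then show "sdg * P * mat_adjoint sdg \<in> pauli_group"
  proof cases
    case 1
    show ?thesis unfolding 1
      by (rule pauli_groupI[of "- 1" pauli_Y])
        (simp_all add: sdg_def pauli_mat2 mat2_adjoint mat2_mult mat2_smult)
  next
    case 2
    show ?thesis unfolding 2
      by (rule pauli_groupI[of 1 pauli_X])
        (simp_all add: sdg_def pauli_mat2 mat2_adjoint mat2_mult mat2_smult)
  next
    case 3
    show ?thesis unfolding 3
      by (rule pauli_groupI[of 1 pauli_Z])
        (simp_all add: sdg_def pauli_mat2 mat2_adjoint mat2_mult mat2_smult)
  qed
qed

section \<open>Conjugation by Hadamard and by X\<close>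

text \<open>For a fixed control bit the middle factor acts on the target as the identity or as
  \<open>Z\<close>, which the Hadamards turn into the identity or \<open>X\<close>.\<close>

lemma cnot_mat_conv_hadamard:
  assumes ct: "c < n" "t < n" "c \<noteq> t"
  shows "cnot_mat n c t = on_qubit n t hadamard *
    (mat_diag (2 ^ n) (\<lambda>r. if bit r c \<and> bit r t then - 1 else 1) * on_qubit n t hadamard)"
    (is "_ = ?H * (?D * ?H)")
proof (rule eq_matI)
  define s where "s = complex_of_real (1 / sqrt 2)"
  have s: "s * s = 1 / 2" unfolding s_def by (rule sqrt_half)
  have h: "hadamard = mat2 s s s (- s)" by (simp add: hadamard_def Let_def s_def)
  fix r l assume "r < dim_row (?H * (?D * ?H))" "l < dim_col (?H * (?D * ?H))"
  then have rl: "r < 2 ^ n" "l < 2 ^ n" by simp_all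
  define Q where "Q \<longleftrightarrow> (\<forall>p<n. p \<noteq> t \<longrightarrow> bit r p = bit l p)"
  have u: "(\<forall>p<n. p \<noteq> t \<longrightarrow> bit (unset_bit t r) p = bit l p) \<longleftrightarrow> Q"
    and v: "(\<forall>p<n. p \<noteq> t \<longrightarrow> bit (set_bit t r) p = bit l p) \<longleftrightarrow> Q"
    by (auto simp: Q_def)
  \<comment> \<open>The nonzero entries of the CNOT read bitwise: agreement off the target,
    exclusive or with the control bit on it.\<close>
  have b: "r = (if bit l c then flip_bit t l else l) \<longleftrightarrow> Q \<and> (bit r t \<longleftrightarrow> bit l t \<noteq> bit l c)"
  proof -
    have "(if bit l c then flip_bit t l else l) < 2 ^ n" using rl ct by simp
    from nat_eq_iff_bits[OF rl(1) this] show ?thesis using ct unfolding Q_def by (auto split: if_splits)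
  qed
  have m: "(?D * ?H) $$ (x, l) = (if bit x c \<and> bit x t then - 1 else 1) * ?H $$ (x, l)"
    if "x < 2 ^ n" for x
    unfolding mat_diag_mult_left[OF on_qubit_carrier] using that rl by simp
  \<comment> \<open>Since \<open>c \<noteq> t\<close>, the control bit is shared by row and column,
    so the sign of the middle factor can be read off from \<open>l\<close>.\<close>
  have Qc: "Q \<Longrightarrow> bit r c = bit l c" using ct by (simp add: Q_def)
  have "?H $$ (unset_bit t r, l) = (if Q then hadamard $$ (0, of_bool (bit l t)) else 0)"
    "?H $$ (set_bit t r, l) = (if Q then hadamard $$ (1, of_bool (bit l t)) else 0)"
    using rl ct by (simp_all only: on_qubit_index bit_ops_less u v) simp_all
  then have "(?H * (?D * ?H)) $$ (r, l) =
      (if Q then hadamard $$ (of_bool (bit r t), 0) * hadamard $$ (0, of_bool (bit l t)) +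
        hadamard $$ (of_bool (bit r t), 1) * (if bit l c then - 1 else 1) * hadamard $$ (1, of_bool (bit l t))
      else 0)"
    using rl ct Qc by (subst on_qubit_mult_index) (auto simp: m mult_carrier_mat[of _ _ "2^n"])
  also have "\<dots> = (if Q \<and> (bit r t \<longleftrightarrow> bit l t \<noteq> bit l c) then 1 else 0)"
    unfolding h by (auto simp: s)
  also have "\<dots> = cnot_mat n c t $$ (r, l)"
    using rl unfolding b[symmetric] by (simp add: cnot_mat_def)
  finally show "cnot_mat n c t $$ (r, l) = (?H * (?D * ?H)) $$ (r, l)" ..
qed (simp_all add: cnot_mat_def)

text \<open>\<open>X\<close> on qubit \<open>q\<close> is the permutation matrix of the involution
  \<open>flip_bit q\<close>: moving it past a diagonal matrix permutes the diagonal, and the two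
  copies then cancel.\<close>

lemma on_qubit_X_conj:
  assumes q: "q < n"
  shows "on_qubit n q pauli_X * mat_diag (2 ^ n) f * on_qubit n q pauli_X =
    mat_diag (2 ^ n) (\<lambda>r. f (flip_bit q r))"
proof -
  let ?X = "on_qubit n q pauli_X"
  let ?g = "\<lambda>r. f (flip_bit q r)"
  have "?X $$ (r, c) * f c = ?g r * ?X $$ (r, c)" if rc: "r < 2 ^ n" "c < 2 ^ n" for r c
  proof (cases "c = flip_bit q r")
    case False
    then have "\<not> ((\<forall>p<n. p \<noteq> q \<longrightarrow> bit r p = bit c p) \<and> bit r q \<noteq> bit c q)"
      using False nat_eq_iff_bits[OF rc(2), of "flip_bit q r"] rc q by (metis bit_flip_nat bit_ops_less(1))
    then have "?X $$ (r, c) = 0"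
      by (cases "bit r q"; cases "bit c q") (auto simp: on_qubit_index[OF rc] pauli_X_def)
    then show ?thesis by simp
  qed simp
  then have c: "?X * mat_diag (2 ^ n) f = mat_diag (2 ^ n) ?g * ?X"
    unfolding mat_diag_mult_left[OF on_qubit_carrier] mat_diag_mult_right[OF on_qubit_carrier]
    by (intro cong_mat) simp_all
  have "?X * ?X = 1\<^sub>m (2 ^ n)"
  proof (rule eq_matI)
    fix r c assume "r < dim_row (1\<^sub>m (2 ^ n) :: complex mat)" "c < dim_col (1\<^sub>m (2 ^ n) :: complex mat)"
    then have rc: "r < 2 ^ n" "c < 2 ^ n" by simp_all
    have "(?X * ?X) $$ (r, c) = (if \<forall>p<n. bit r p = bit c p then 1 else 0)"
      using rc q by (subst on_qubit_mult_index) (auto simp: on_qubit_index pauli_X_def)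
    then show "(?X * ?X) $$ (r, c) = 1\<^sub>m (2 ^ n) $$ (r, c)"
      using rc by (simp add: nat_eq_iff_bits)
  qed simp_all
  then show ?thesis
    unfolding c by (simp add: assoc_mult_mat[of _ "2 ^ n" "2 ^ n" _ "2 ^ n" _ "2 ^ n"]
        right_mult_one_mat[of _ "2 ^ n" "2 ^ n"])
qed

section \<open>Composition of circuits up to global phase\<close>

lemma mat_exp_carrier: "A \<in> carrier_mat m m \<Longrightarrow> mat_exp A \<in> carrier_mat m m"
  by (auto simp: mat_exp_def)

lemma gzz_mat_carrier: "gzz_mat n Q \<alpha> \<in> carrier_mat (2 ^ n) (2 ^ n)"
proof -
  have "foldr (\<lambda>(i, j) M.
        mat_exp ((- \<i> * of_real (\<alpha> / 2)) \<cdot>\<^sub>m (on_qubit n i pauli_Z * on_qubit n j pauli_Z)) * M)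
      xs (1\<^sub>m (2 ^ n)) \<in> carrier_mat (2 ^ n) (2 ^ n)" for xs
    by (induction xs) (auto intro!: mult_carrier_mat[of _ _ "2 ^ n"] mat_exp_carrier)
  then show ?thesis by (simp add: gzz_mat_def)
qed

lemma gate_mat_carrier [simp]: "gate_mat n g \<in> carrier_mat (2 ^ n) (2 ^ n)"
  by (cases g) (simp_all add: gzz_mat_carrier, simp add: cnot_mat_def)

lemma circuit_mat_carrier [simp]: "circuit_mat n C \<in> carrier_mat (2 ^ n) (2 ^ n)"
  by (induction C) (auto intro!: mult_carrier_mat[of _ _ "2 ^ n"])

lemma circuit_mat_append: "circuit_mat n (C @ D) = circuit_mat n D * circuit_mat n C"
  by (induction C) (simp_all add: right_mult_one_mat[of _ "2 ^ n" "2 ^ n"]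
      assoc_mult_mat[of _ "2 ^ n" "2 ^ n" _ "2 ^ n" _ "2 ^ n"])

lemma one_smult_mat:
  fixes A :: "'a :: monoid_mult mat"
  shows "1 \<cdot>\<^sub>m A = A"
  by (intro eq_matI) auto

lemma synthesises_Nil: "synthesises n [] []"
  unfolding synthesises_def by (rule exI[of _ 0]) (simp add: one_smult_mat)

lemma smult_smult_mat:
  fixes a :: "'a :: semigroup_mult"
  shows "a \<cdot>\<^sub>m (b \<cdot>\<^sub>m A) = (a * b) \<cdot>\<^sub>m A"
  by (intro eq_matI) (auto simp: mult.assoc)

text \<open>Scalars pass through matrix products, so global phases add; this allows a circuit to be
  synthesised layer by layer.\<close>

lemma synthesises_append:
  assumes "synthesises n C' C" "synthesises n D' D"
  shows "synthesises n (C' @ D') (C @ D)"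
proof -
  obtain s t where "circuit_mat n C' = cis s \<cdot>\<^sub>m circuit_mat n C"
    "circuit_mat n D' = cis t \<cdot>\<^sub>m circuit_mat n D"
    using assms unfolding synthesises_def by blast
  then have "circuit_mat n (C' @ D') = cis (s + t) \<cdot>\<^sub>m circuit_mat n (C @ D)"
    unfolding circuit_mat_append cis_mult[symmetric] smult_smult_mat[symmetric]
    by (simp add: mult_smult_distrib[of _ "2 ^ n" "2 ^ n" _ "2 ^ n"]
        mult_smult_assoc_mat[of _ "2 ^ n" "2 ^ n" _ "2 ^ n"])
  then show ?thesis unfolding synthesises_def by blast
qed

section \<open>Layers of equal local gates\<close>

definition local_layer :: "complex mat \<Rightarrow> nat list \<Rightarrow> circuit" where
  "local_layer U qs = map (\<lambda>q. Local q U) qs"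

lemma local_layer_simps [simp]:
  "local_layer U [] = []" "local_layer U (q # qs) = Local q U # local_layer U qs"
  by (simp_all add: local_layer_def)

lemma local_layer_commute_on_qubit:
  assumes "p < n" "p \<notin> set qs" "set qs \<subseteq> {..<n}"
  shows "circuit_mat n (local_layer U qs) * on_qubit n p V =
    on_qubit n p V * circuit_mat n (local_layer U qs)"
  using assms
proof (induction qs)
  case Nil
  then show ?case by (simp add: left_mult_one_mat[of _ "2 ^ n" "2 ^ n"]
        right_mult_one_mat[of _ "2 ^ n" "2 ^ n"])
next
  case (Cons q qs)
  let ?M = "circuit_mat n (local_layer U qs)" and ?U = "on_qubit n q U" and ?V = "on_qubit n p V"
  note assoc = assoc_mult_mat[of _ "2 ^ n" "2 ^ n" _ "2 ^ n" _ "2 ^ n"]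
    mult_carrier_mat[of _ "2 ^ n" "2 ^ n" _ "2 ^ n"]
  have "?M * ?U * ?V = ?M * (?U * ?V)" by (simp add: assoc)
  also have "?U * ?V = ?V * ?U" using Cons.prems by (intro on_qubit_commute) auto
  also have "?M * (?V * ?U) = ?M * ?V * ?U" by (simp add: assoc)
  also have "?M * ?V = ?V * ?M" using Cons by simp
  finally show ?case by (simp add: assoc)
qed

lemma local_layer_commute_diag:
  assumes "\<And>q r c. q \<in> set qs \<Longrightarrow> r < 2 ^ n \<Longrightarrow> c < 2 ^ n \<Longrightarrow>
    \<forall>p<n. p \<noteq> q \<longrightarrow> bit r p = bit c p \<Longrightarrow> f r = f c"
  shows "circuit_mat n (local_layer U qs) * mat_diag (2 ^ n) f =
    mat_diag (2 ^ n) f * circuit_mat n (local_layer U qs)"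
  using assms
proof (induction qs)
  case Nil
  then show ?case by (simp add: left_mult_one_mat[of _ "2 ^ n" "2 ^ n"]
        right_mult_one_mat[of _ "2 ^ n" "2 ^ n"])
next
  case (Cons q qs)
  let ?M = "circuit_mat n (local_layer U qs)" and ?U = "on_qubit n q U" and ?V = "mat_diag (2 ^ n) f"
  note assoc = assoc_mult_mat[of _ "2 ^ n" "2 ^ n" _ "2 ^ n" _ "2 ^ n"]
    mult_carrier_mat[of _ "2 ^ n" "2 ^ n" _ "2 ^ n"]
  have "?M * ?U * ?V = ?M * (?U * ?V)" by (simp add: assoc)
  also have "?U * ?V = ?V * ?U" by (intro on_qubit_commute_diag Cons.prems[of q]) auto
  also have "?M * (?V * ?U) = ?M * ?V * ?U" by (simp add: assoc)
  also have "?M * ?V = ?V * ?M" by (rule Cons.IH, rule Cons.prems) auto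
  finally show ?case by (simp add: assoc)
qed

lemma local_layer_sdg:
  assumes "set qs \<subseteq> {..<n}"
  shows "circuit_mat n (local_layer sdg qs) =
    mat_diag (2 ^ n) (\<lambda>r. \<Prod>q\<leftarrow>qs. if bit r q then - \<i> else 1)"
  using assms
  by (induction qs) (auto simp: sdg_def on_qubit_diag intro!: mat_diag_cong)

text \<open>Gates on distinct qubits commute, so the same list, without reversal, serves on both
  sides; nested conjugations by \<open>X\<close> then flip one bit after another.\<close>

lemma local_layer_X_conj:
  assumes "set qs \<subseteq> {..<n}" "distinct qs"
  shows "circuit_mat n (local_layer pauli_X qs) * mat_diag (2 ^ n) f *
      circuit_mat n (local_layer pauli_X qs) =
    mat_diag (2 ^ n) (\<lambda>r. f (fold flip_bit qs r))"
  using assms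
proof (induction qs)
  case Nil
  then show ?case by (simp add: left_mult_one_mat[of _ "2 ^ n" "2 ^ n"]
        right_mult_one_mat[of _ "2 ^ n" "2 ^ n"])
next
  case (Cons q qs)
  let ?M = "circuit_mat n (local_layer pauli_X qs)" and ?X = "on_qubit n q pauli_X"
    and ?D = "mat_diag (2 ^ n) f"
  note assoc = assoc_mult_mat[of _ "2 ^ n" "2 ^ n" _ "2 ^ n" _ "2 ^ n"]
    mult_carrier_mat[of _ "2 ^ n" "2 ^ n" _ "2 ^ n"]
  have MX: "?M * ?X = ?X * ?M" using Cons.prems by (intro local_layer_commute_on_qubit) auto
  have "?M * ?X * ?D * (?M * ?X) = ?X * ?M * ?D * (?M * ?X)" by (simp only: MX)
  also have "\<dots> = ?X * (?M * ?D * ?M) * ?X"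
    by (simp add: assoc)
  also have "?M * ?D * ?M = mat_diag (2 ^ n) (\<lambda>r. f (fold flip_bit qs r))" using Cons by simp
  finally show ?case using Cons.prems by (simp add: on_qubit_X_conj)
qed

text \<open>Distinctness ensures that no bit is flipped twice.\<close>

lemma zval_fold_flip:
  "distinct qs \<Longrightarrow> zval (fold flip_bit qs r) p = (if p \<in> set qs then - 1 else 1) * zval r p"
  by (induction qs arbitrary: r) (auto simp: zval_def)

section \<open>CNOT layers as lists of disjoint pairs\<close>

definition cnots :: "(nat \<times> nat) list \<Rightarrow> circuit" where
  "cnots P = map (\<lambda>(c, t). CNOT c t) P"

text \<open>Keeping this as a list makes \<open>distinct (touched P)\<close> say at once that each
  pair consists of two different qubits and that the pairs are disjoint.\<close>

definition touched :: "(nat \<times> nat) list \<Rightarrow> nat list" where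
  "touched P = concat (map (\<lambda>(c, t). [c, t]) P)"

lemma touched_simps [simp]:
  "touched [] = []" "touched ((c, t) # P) = c # t # touched P"
  by (simp_all add: touched_def)

lemma cnots_simps [simp]:
  "cnots [] = []" "cnots ((c, t) # P) = CNOT c t # cnots P"
  by (simp_all add: cnots_def)

lemma touched_mem: "(c, t) \<in> set P \<Longrightarrow> c \<in> set (touched P) \<and> t \<in> set (touched P)"
  by (induction P) auto

text \<open>The pairs form an oriented matching: a shared qubit determines the pair and its
  orientation.\<close>

lemma touched_disjoint:
  assumes "distinct (touched P)" "(c, t) \<in> set P" "(c', t') \<in> set P" "{c, t} \<inter> {c', t'} \<noteq> {}"
  shows "(c, t) = (c', t')"
  using assms
proof (induction P)
  case (Cons p P)
  obtain a b where p: "p = (a, b)" by (cases p)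
  show ?case
    using Cons touched_mem[of c t P] touched_mem[of c' t' P] by (auto simp: p)
qed simp

lemma touched_neq: "distinct (touched P) \<Longrightarrow> (c, t) \<in> set P \<Longrightarrow> c \<noteq> t"
  by (induction P) auto

lemma touched_distinct: "distinct (touched P) \<Longrightarrow> distinct P"
  by (induction P) (auto dest: touched_mem)

lemma targets_touched: "set (map snd P) \<subseteq> set (touched P)"
  using touched_mem by fastforce

lemma cnot_layer_cnots:
  assumes "cnot_layer n L"
  obtains P where "L = cnots P" "distinct (touched P)" "set (touched P) \<subseteq> {..<n}"
proof -
  \<comment> \<open>The equation for \<open>set (touched P)\<close> strengthens the induction: it
    turns disjointness of gates into freshness of the qubits of the head.\<close>
  have "\<exists>P. L = cnots P \<and> distinct (touched P) \<and> set (touched P) \<subseteq> {..<n} \<and>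
      set (touched P) = (\<Union>g\<in>set L. gate_qubits g)"
    using assms
  proof (induction L)
    case Nil
    then show ?case by (auto intro: exI[of _ "[]"])
  next
    case (Cons g L)
    have dis: "\<And>i j. i < Suc (length L) \<Longrightarrow> j < Suc (length L) \<Longrightarrow> i \<noteq> j \<Longrightarrow>
        gate_qubits ((g # L) ! i) \<inter> gate_qubits ((g # L) ! j) = {}"
      using Cons.prems by (simp add: cnot_layer_def)
    have "cnot_layer n L"
      unfolding cnot_layer_def
    proof (intro conjI allI impI)
      show "\<forall>g\<in>set L. \<exists>c t. g = CNOT c t \<and> c < n \<and> t < n \<and> c \<noteq> t"
        using Cons.prems by (simp add: cnot_layer_def)
      show "gate_qubits (L ! i) \<inter> gate_qubits (L ! j) = {}"
        if "i < length L" "j < length L" "i \<noteq> j" for i j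
        using that dis[of "Suc i" "Suc j"] by simp
    qed
    with Cons.IH obtain P where P: "L = cnots P" "distinct (touched P)" "set (touched P) \<subseteq> {..<n}"
      "set (touched P) = (\<Union>g\<in>set L. gate_qubits g)" by blast
    obtain c t where g: "g = CNOT c t" "c < n" "t < n" "c \<noteq> t"
      using Cons.prems by (auto simp: cnot_layer_def)
    have "gate_qubits g \<inter> gate_qubits x = {}" if "x \<in> set L" for x
    proof -
      from that obtain j where "j < length L" "x = L ! j" by (metis in_set_conv_nth)
      then show ?thesis using dis[of 0 "Suc j"] by simp
    qed
    then have "c \<notin> set (touched P)" "t \<notin> set (touched P)" using P(4) g(1) by auto
    then show ?case using P g by (intro exI[of _ "(c, t) # P"]) auto
  qed
  then show ?thesis using that by blast
qed

text \<open>The diagonal entry of a controlled-\<open>Z\<close> gate at the basis state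
  \<open>r\<close>.\<close>

definition cz :: "nat \<Rightarrow> nat \<times> nat \<Rightarrow> complex" where
  "cz r = (\<lambda>(c, t). if bit r c \<and> bit r t then - 1 else 1)"

text \<open>Targets of a layer are disjoint from all other qubits of the layer, so the Hadamards
  commute past the other gates and can be collected at both ends.\<close>

lemma circuit_mat_cnots:
  assumes "distinct (touched P)" "set (touched P) \<subseteq> {..<n}"
  shows "circuit_mat n (cnots P) =
    circuit_mat n (local_layer hadamard (map snd P)) *
    mat_diag (2 ^ n) (\<lambda>r. \<Prod>p\<leftarrow>P. cz r p) *
    circuit_mat n (local_layer hadamard (map snd P))"
  using assms
proof (induction P)
  case Nil
  then show ?case by (simp add: left_mult_one_mat[of _ "2 ^ n" "2 ^ n"])
next
  case (Cons p P)
  obtain c t where p: "p = (c, t)" by (cases p)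
  let ?M = "circuit_mat n (local_layer hadamard (map snd P))"
  let ?D = "mat_diag (2 ^ n) (\<lambda>r. \<Prod>p\<leftarrow>P. cz r p)"
  let ?H = "on_qubit n t hadamard"
  let ?Z = "mat_diag (2 ^ n) (\<lambda>r. cz r (c, t))"
  note assoc = assoc_mult_mat[of _ "2 ^ n" "2 ^ n" _ "2 ^ n" _ "2 ^ n"]
    mult_carrier_mat[of _ "2 ^ n" "2 ^ n" _ "2 ^ n"]
  have ct: "c < n" "t < n" "c \<noteq> t" "c \<notin> set (touched P)" "t \<notin> set (touched P)"
    using Cons.prems by (auto simp: p)
  have MH: "?M * ?H = ?H * ?M"
    by (rule local_layer_commute_on_qubit) (use ct Cons.prems targets_touched[of P] p in auto)
  \<comment> \<open>The Hadamards in \<open>?M\<close> sit on targets of \<open>P\<close>, none of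
    which is \<open>c\<close> or \<open>t\<close>.\<close>
  have MZ: "?M * ?Z = ?Z * ?M"
  proof (rule local_layer_commute_diag)
    fix q r c' :: nat assume "q \<in> set (map snd P)" "\<forall>p<n. p \<noteq> q \<longrightarrow> bit r p = bit c' p"
    moreover from this have "c \<noteq> q" "t \<noteq> q" using targets_touched[of P] ct by auto
    ultimately show "cz r (c, t) = cz c' (c, t)" using ct by (simp add: cz_def)
  qed
  have DH: "?D * ?H = ?H * ?D"
  proof (rule on_qubit_commute_diag[symmetric])
    fix r c' :: nat assume a: "\<forall>p<n. p \<noteq> t \<longrightarrow> bit r p = bit c' p"
    have "cz r x = cz c' x" if "x \<in> set P" for x
    proof -
      obtain c1 t1 where x: "x = (c1, t1)" by (cases x)
      have "c1 < n" "t1 < n" "c1 \<noteq> t" "t1 \<noteq> t"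
        using touched_mem[of c1 t1 P] that x ct Cons.prems by (auto simp: p)
      then show ?thesis using a by (simp add: x cz_def)
    qed
    then show "(\<Prod>p\<leftarrow>P. cz r p) = (\<Prod>p\<leftarrow>P. cz c' p)"
      by (metis map_cong)
  qed
  have Z: "cnot_mat n c t = ?H * (?Z * ?H)"
    using cnot_mat_conv_hadamard[OF ct(1-3)] by (simp add: cz_def)
  \<comment> \<open>The first gate of the list is the rightmost factor. Its left Hadamard moves past
    \<open>?M\<close> and \<open>?D\<close>, and \<open>?Z\<close> past \<open>?M\<close>, so that
    diagonals meet diagonals and Hadamards meet Hadamards.\<close>
  have "circuit_mat n (cnots (p # P)) = ?M * ?D * ?M * (?H * (?Z * ?H))"
    using Cons by (simp add: p Z)
  also have "\<dots> = ?M * ?D * (?M * ?H) * (?Z * ?H)" by (simp add: assoc)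
  also have "\<dots> = ?M * (?D * ?H) * (?M * ?Z) * ?H" unfolding MH by (simp add: assoc)
  also have "\<dots> = ?M * ?H * (?D * ?Z) * (?M * ?H)" unfolding DH MZ by (simp add: assoc del: mat_diag_diag)
  also have "?D * ?Z = mat_diag (2 ^ n) (\<lambda>r. \<Prod>p\<leftarrow>p # P. cz r p)"
    by (simp add: p mult.commute)
  finally show ?case by (simp add: p)
qed

section \<open>Controlled-Z phases as ZZ rotations\<close>

text \<open>Checked on the four bit values: equal bits give the exponential
  \<open>cis (- pi / 4)\<close>, which cancels the prefactor and leaves \<open>1\<close> or
  \<open>(- \<i>) * (- \<i>) = - 1\<close>; unequal bits are treated separately.\<close>

lemma cz_conv_zval:
  "cz r (c, t) = cis (pi / 4) *
    ((if bit r c then - \<i> else 1) * (if bit r t then - \<i> else 1)) *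
    exp (- \<i> * of_real (pi / 4 * (zval r c * zval r t)))"
proof -
  have e: "exp (- \<i> * of_real (pi / 4 * x)) = cis (- (pi / 4 * x))" for x
    by (simp add: cis_conv_exp)
  \<comment> \<open>For unequal bits the exponential is \<open>cis (pi / 4)\<close> and one factor
    \<open>- \<i>\<close> occurs; the two phases combine to
    \<open>cis (pi / 2) = \<i>\<close>.\<close>
  have "cis (pi / 4) * \<i> * cis (pi / 4) = \<i> * (cis (pi / 4) * cis (pi / 4))" by simp
  also have "\<dots> = - 1" by (simp only: cis_mult) simp
  finally have "cis (pi / 4) * \<i> * cis (pi / 4) = - 1" .
  then show ?thesis unfolding e
    by (auto simp: cz_def zval_def cis_mult)
qed

text \<open>The factors \<open>cis (pi / 4)\<close>, one per pair, do not depend on \<open>r\<close>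
  and collect into a global phase.\<close>

lemma prod_cz_conv_zval:
  "(\<Prod>p\<leftarrow>P. cz r p) = cis (pi / 4 * length P) *
    (\<Prod>q\<leftarrow>touched P. if bit r q then - \<i> else 1) *
    exp (- \<i> * of_real (pi / 4 * (\<Sum>(c, t)\<leftarrow>P. zval r c * zval r t)))"
proof (induction P)
  case (Cons p P)
  obtain c t where p: "p = (c, t)" by (cases p)
  have "cis (pi / 4 * length (p # P)) = cis (pi / 4) * cis (pi / 4 * length P)"
    by (simp add: cis_mult add_divide_distrib distrib_left)
  moreover have "exp (- \<i> * of_real (pi / 4 * (\<Sum>(c, t)\<leftarrow>p # P. zval r c * zval r t))) =
      exp (- \<i> * of_real (pi / 4 * (zval r c * zval r t))) *
      exp (- \<i> * of_real (pi / 4 * (\<Sum>(c, t)\<leftarrow>P. zval r c * zval r t)))"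
    by (simp add: p exp_add[symmetric] algebra_simps)
  ultimately show ?case
    by (simp only: p Cons.IH cz_conv_zval list.map prod_list.Cons touched_simps) (simp add: mult_ac)
qed simp

section \<open>Sylvester-Hadamard signs and the labelling of paired qubits\<close>

lemma sum_lessThan_add:
  fixes f :: "nat \<Rightarrow> 'a :: comm_monoid_add"
  shows "(\<Sum>i<m + n. f i) = (\<Sum>i<m. f i) + (\<Sum>i<n. f (m + i))"
  by (induction n) (simp_all add: add.assoc)

text \<open>The block recursion \<open>[[S, S], [S, - S]]\<close>: for indices below
  \<open>2 ^ Suc k\<close> the top bits of \<open>a\<close> and \<open>b\<close> select the block,
  the residues the entry in it.\<close>

fun sylvester :: "nat \<Rightarrow> nat \<Rightarrow> nat \<Rightarrow> real" where
  "sylvester 0 a b = 1"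
| "sylvester (Suc k) a b = sylvester k (a mod 2 ^ k) (b mod 2 ^ k) *
    (if 2 ^ k \<le> a \<and> 2 ^ k \<le> b then - 1 else 1)"

lemma sylvester_cases: "sylvester k a b = 1 \<or> sylvester k a b = - 1"
proof (induction k arbitrary: a b)
  case (Suc k)
  from Suc.IH[of "a mod 2 ^ k" "b mod 2 ^ k"] show ?case by auto
qed simp

text \<open>The columns split into two halves with equal inner products up to the sign
  \<open>?s a * ?s a'\<close>. Rows with different residues are orthogonal in each half; with equal
  residues the halves cancel for different top bits and add up for equal ones.\<close>

lemma sylvester_orthogonal:
  assumes "a < 2 ^ k" "a' < 2 ^ k"
  shows "(\<Sum>b<2 ^ k. sylvester k a b * sylvester k a' b) = (if a = a' then 2 ^ k else 0)"
  using assms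
proof (induction k arbitrary: a a')
  case (Suc k)
  let ?N = "2 ^ k :: nat"
  let ?s = "\<lambda>x. if ?N \<le> x then - 1 else 1 :: real"
  let ?S = "\<Sum>b<?N. sylvester k (a mod ?N) b * sylvester k (a' mod ?N) b"
  have "(\<Sum>b<2 ^ Suc k. sylvester (Suc k) a b * sylvester (Suc k) a' b) =
      (\<Sum>b<?N. sylvester (Suc k) a b * sylvester (Suc k) a' b) +
      (\<Sum>b<?N. sylvester (Suc k) a (?N + b) * sylvester (Suc k) a' (?N + b))"
    by (simp only: power_Suc mult_2 sum_lessThan_add)
  also have "\<dots> = ?S + ?s a * ?s a' * ?S"
    unfolding sum_distrib_left by (intro arg_cong2[of _ _ _ _ "(+)"] sum.cong) auto
  also have "?S = (if a mod ?N = a' mod ?N then 2 ^ k else 0)"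
    by (rule Suc.IH) simp_all
  finally show ?case
  proof -
    assume *: "(\<Sum>b<2 ^ Suc k. sylvester (Suc k) a b * sylvester (Suc k) a' b) =
      (if a mod ?N = a' mod ?N then 2 ^ k else 0) +
      ?s a * ?s a' * (if a mod ?N = a' mod ?N then 2 ^ k else 0)"
    have m: "x mod ?N = (if ?N \<le> x then x - ?N else x)" if "x < 2 ^ Suc k" for x
      using that by (auto simp: mod_if)
    show ?thesis
      unfolding * using Suc.prems by (auto simp: m)
  qed
qed simp

text \<open>Contracting each pair to its control frees one row label per pair.\<close>

lemma pair_labelling:
  assumes P: "distinct (touched P)" "set (touched P) \<subseteq> {..<n}" "P \<noteq> []" and m: "n \<le> Suc m"
  obtains f :: "nat \<Rightarrow> nat" where "\<forall>i<n. f i < m"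
    and "\<forall>i<n. \<forall>j<n. i \<noteq> j \<longrightarrow> f i = f j \<longleftrightarrow> (i, j) \<in> set P \<or> (j, i) \<in> set P"
proof -
  \<comment> \<open>The contraction: a target goes to its control, unique by disjointness; every
    other qubit is fixed.\<close>
  define \<rho> where "\<rho> i = (if i \<in> snd ` set P then THE c. (c, i) \<in> set P else i)" for i
  note dis = touched_disjoint[OF P(1)] and neq = touched_neq[OF P(1)]
  have \<rho>_t: "\<rho> t = c" if "(c, t) \<in> set P" for c t
  proof -
    have "c' = c" if "(c', t) \<in> set P" for c'
      using dis[OF that \<open>(c, t) \<in> set P\<close>] by simp
    then have "(THE c. (c, t) \<in> set P) = c" using that by blast
    moreover have "t \<in> snd ` set P" using that by (metis image_eqI snd_conv)
    ultimately show ?thesis by (simp add: \<rho>_def)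
  qed
  have c_not: "c \<notin> snd ` set P" if "(c, t) \<in> set P" for c t
  proof
    assume "c \<in> snd ` set P"
    then obtain c' where c': "(c', c) \<in> set P" by auto
    show False using dis[OF c' that] neq[OF that] by simp
  qed
  have \<rho>_other: "\<rho> i = i" if "i \<notin> snd ` set P" for i using that by (simp add: \<rho>_def)
  have \<rho>_lt: "\<rho> i < n" if "i < n" for i
  proof (cases "i \<in> snd ` set P")
    case True
    then obtain c where "(c, i) \<in> set P" by auto
    then show ?thesis using \<rho>_t[of c i] touched_mem[of c i P] P(2) by auto
  qed (simp add: \<rho>_other that)
  have \<rho>_not: "\<rho> i \<notin> snd ` set P" for i
  proof (cases "i \<in> snd ` set P")
    case True
    then obtain c where "(c, i) \<in> set P" by auto
    then show ?thesis using \<rho>_t c_not by metis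
  qed (simp add: \<rho>_other)
  have \<rho>_eq: "\<rho> i = \<rho> j \<longleftrightarrow> (i, j) \<in> set P \<or> (j, i) \<in> set P" if "i \<noteq> j" for i j
  proof
    assume e: "\<rho> i = \<rho> j"
    \<comment> \<open>Two targets with a common control would belong to the same pair and be equal.
      If one qubit is not a target, it is fixed by \<open>\<rho>\<close> and hence is the control of
      the other.\<close>
    consider "i \<in> snd ` set P" "j \<in> snd ` set P" | "i \<notin> snd ` set P" | "j \<notin> snd ` set P" by blast
    then show "(i, j) \<in> set P \<or> (j, i) \<in> set P"
    proof cases
      case 1
      then obtain a b where ab: "(a, i) \<in> set P" "(b, j) \<in> set P" by auto
      then have "a = b" using e \<rho>_t by metis
      then show ?thesis using dis[OF ab] that by simp
    next
      case 2
      then have "j \<in> snd ` set P" "\<rho> j = i" using e \<rho>_other that by (metis, metis)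
      then show ?thesis using \<rho>_t by fastforce
    next
      case 3
      then have "i \<in> snd ` set P" "\<rho> i = j" using e \<rho>_other that by (metis, metis)
      then show ?thesis using \<rho>_t by fastforce
    qed
  next
    assume "(i, j) \<in> set P \<or> (j, i) \<in> set P"
    then show "\<rho> i = \<rho> j" using \<rho>_t \<rho>_other c_not by metis
  qed
  \<comment> \<open>No value of \<open>\<rho>\<close> is a target, so dropping one target leaves
    \<open>n - 1\<close> possible values, and \<open>n \<le> Suc m\<close> allows these to be
    injected into \<open>m\<close> labels.\<close>
  obtain c0 t0 where ct: "(c0, t0) \<in> set P" using P(3) by (cases P) auto
  then have t0: "t0 < n" "t0 \<in> snd ` set P" using touched_mem P(2) by force+
  have "card ({..<n} - {t0}) \<le> card {..<m}" using t0 m by simp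
  then obtain e where e: "e ` ({..<n} - {t0}) \<subseteq> {..<m}" "inj_on e ({..<n} - {t0})"
    using card_le_inj[of "{..<n} - {t0}" "{..<m}"] by auto
  have R: "\<rho> i \<in> {..<n} - {t0}" if "i < n" for i
    using \<rho>_lt[OF that] \<rho>_not[of i] t0 by auto
  show ?thesis
  proof (rule that[of "\<lambda>i. e (\<rho> i)"])
    show "\<forall>i<n. e (\<rho> i) < m" using R e(1) by blast
    show "\<forall>i<n. \<forall>j<n. i \<noteq> j \<longrightarrow> e (\<rho> i) = e (\<rho> j) \<longleftrightarrow> (i, j) \<in> set P \<or> (j, i) \<in> set P"
      using inj_on_eq_iff[OF e(2) R R] \<rho>_eq by simp
  qed
qed

text \<open>Sorting the two qubits of each pair is injective on a matching, and symmetry of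
  \<open>g\<close> makes the orientation immaterial.\<close>

lemma sum_ordered_pairs:
  fixes g :: "nat \<Rightarrow> nat \<Rightarrow> real"
  assumes P: "distinct (touched P)" "set (touched P) \<subseteq> {..<n}" and g: "\<And>i j. g i j = g j i"
  shows "(\<Sum>(i, j)\<in>{(i, j). i < j \<and> j < n}. if (i, j) \<in> set P \<or> (j, i) \<in> set P then g i j else 0) =
    (\<Sum>(c, t)\<leftarrow>P. g c t)"
proof -
  let ?A = "{(i, j). i < j \<and> j < n}"
  let ?B = "{(i, j). i < j \<and> ((i, j) \<in> set P \<or> (j, i) \<in> set P)}"
  let ?h = "\<lambda>(c :: nat, t :: nat). (min c t, max c t)"
  have mem: "c < n" "t < n" "c \<noteq> t" if "(c, t) \<in> set P" for c t
    using touched_mem[OF that] P(2) touched_neq[OF P(1) that] by auto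
  have "finite ?A" by (rule finite_subset[of _ "{..<n} \<times> {..<n}"]) auto
  then have "(\<Sum>(i, j)\<in>?A. if (i, j) \<in> set P \<or> (j, i) \<in> set P then g i j else 0) =
      (\<Sum>(i, j)\<in>?B. g i j)"
    by (intro sum.mono_neutral_cong_right) (auto dest: mem split: if_splits)
  also have "?B = ?h ` set P"
  proof
    show "?h ` set P \<subseteq> ?B"
    proof clarify
      fix c t assume "(c, t) \<in> set P"
      then show "min c t < max c t \<and> ((min c t, max c t) \<in> set P \<or> (max c t, min c t) \<in> set P)"
        using mem(3)[of c t] by (cases "c < t") (simp_all add: min_def max_def)
    qed
    show "?B \<subseteq> ?h ` set P"
    proof
      fix x assume "x \<in> ?B"
      then obtain i j where x: "x = (i, j)" "i < j" "(i, j) \<in> set P \<or> (j, i) \<in> set P" by auto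
      then have "x = ?h (i, j)" "x = ?h (j, i)" by auto
      then show "x \<in> ?h ` set P" using x(3) by blast
    qed
  qed
  also have "(\<Sum>(i, j)\<in>?h ` set P. g i j) = (\<Sum>x\<in>set P. case ?h x of (i, j) \<Rightarrow> g i j)"
  proof (rule sum.reindex[unfolded comp_def])
    show "inj_on ?h (set P)"
    proof (rule inj_onI, clarify)
      fix c t c' t' assume *: "(c, t) \<in> set P" "(c', t') \<in> set P" "min c t = min c' t'" "max c t = max c' t'"
      \<comment> \<open>Equal minima already give a common qubit.\<close>
      then have "{c, t} \<inter> {c', t'} \<noteq> {}" by (auto simp: min_def split: if_splits)
      then show "c = c' \<and> t = t'" using touched_disjoint[OF P(1) *(1,2)] by simp
    qed
  qed
  also have "\<dots> = (\<Sum>(c, t)\<in>set P. g c t)"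
    by (intro sum.cong) (auto simp: min_def max_def g)
  also have "\<dots> = (\<Sum>(c, t)\<leftarrow>P. g c t)"
    by (rule sum_list_distinct_conv_sum_set[OF touched_distinct[OF P(1)], symmetric])
  finally show ?thesis .
qed

section \<open>GZZ rounds with signs\<close>

definition signed_gzz :: "nat \<Rightarrow> real \<Rightarrow> (nat \<Rightarrow> real) \<Rightarrow> circuit" where
  "signed_gzz n \<alpha> x = (let X = local_layer pauli_X (filter (\<lambda>q. x q = - 1) [0..<n])
    in X @ [untargeted_gzz n \<alpha>] @ X)"

text \<open>The flips multiply each \<open>zval r q\<close> by \<open>x q\<close>. The values must
  be signs, since every value other than \<open>- 1\<close> is treated as \<open>1\<close> by the
  filter.\<close>

lemma circuit_mat_signed_gzz:
  assumes "\<And>q. x q = 1 \<or> x q = - 1"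
  shows "circuit_mat n (signed_gzz n \<alpha> x) = mat_diag (2 ^ n) (\<lambda>r.
    exp (- \<i> * of_real (\<alpha> / 2 * (\<Sum>(i, j)\<in>{(i, j). i < j \<and> j < n}.
      x i * x j * (zval r i * zval r j)))))"
proof -
  let ?qs = "filter (\<lambda>q. x q = - 1) [0..<n]"
  let ?X = "circuit_mat n (local_layer pauli_X ?qs)"
  let ?A = "{(i :: nat, j). i < j \<and> j < n}"
  have z: "zval (fold flip_bit ?qs r) q = x q * zval r q" if "q < n" for q r
    using assms[of q] that by (auto simp: zval_fold_flip)
  have sgn: "(\<Sum>(i, j)\<in>?A. zval (fold flip_bit ?qs r) i * zval (fold flip_bit ?qs r) j) =
      (\<Sum>(i, j)\<in>?A. x i * x j * (zval r i * zval r j))" for r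
    by (rule sum.cong[OF refl]) (auto simp: z)
  have "circuit_mat n (signed_gzz n \<alpha> x) = ?X * gzz_mat n {..<n} \<alpha> * ?X"
    by (simp add: signed_gzz_def Let_def circuit_mat_append untargeted_gzz_def
        left_mult_one_mat[of _ "2 ^ n" "2 ^ n"])
  also have "\<dots> = mat_diag (2 ^ n) (\<lambda>r. exp (- \<i> * of_real (\<alpha> / 2 *
      (\<Sum>(i, j)\<in>?A. zval (fold flip_bit ?qs r) i * zval (fold flip_bit ?qs r) j))))"
    unfolding gzz_mat_diag by (rule local_layer_X_conj) auto
  finally show ?thesis unfolding sgn .
qed

text \<open>Products of diagonal matrices add exponents, so the coefficient of a pair becomes the
  inner product of the sign sequences of its two qubits.\<close>

lemma circuit_mat_signed_gzz_rounds:
  assumes "\<And>b q. x b q = 1 \<or> x b q = - 1"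
  shows "circuit_mat n (concat (map (\<lambda>b. signed_gzz n \<alpha> (x b)) bs)) = mat_diag (2 ^ n) (\<lambda>r.
    exp (- \<i> * of_real (\<alpha> / 2 * (\<Sum>(i, j)\<in>{(i, j). i < j \<and> j < n}.
      (\<Sum>b\<leftarrow>bs. x b i * x b j) * (zval r i * zval r j)))))"
proof (induction bs)
  case (Cons b bs)
  have "exp (- \<i> * of_real (\<alpha> / 2 * (\<Sum>(i, j)\<in>A. f i j))) *
      exp (- \<i> * of_real (\<alpha> / 2 * (\<Sum>(i, j)\<in>A. g i j))) =
    exp (- \<i> * of_real (\<alpha> / 2 * (\<Sum>(i, j)\<in>A. g i j + f i j)))" for A :: "(nat \<times> nat) set" and f g
    by (simp add: case_prod_unfold sum.distrib exp_add[symmetric] algebra_simps add_divide_distrib)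
  then show ?case
    by (simp only: list.map concat.simps circuit_mat_append Cons.IH circuit_mat_signed_gzz[OF assms]
        mat_diag_diag sum_list.Cons distrib_right)
qed (simp add: case_prod_unfold)

lemma signed_gzz_gates:
  "g \<in> set (signed_gzz n \<alpha> x) \<Longrightarrow> local_clifford_gate n g \<or> g = untargeted_gzz n \<alpha>"
  by (auto simp: signed_gzz_def Let_def local_layer_def local_clifford_gate_def local_clifford_X)

lemma local_layer_gates:
  "local_clifford U \<Longrightarrow> set qs \<subseteq> {..<n} \<Longrightarrow> g \<in> set (local_layer U qs) \<Longrightarrow> local_clifford_gate n g"
  by (auto simp: local_layer_def local_clifford_gate_def)

lemma gzz_count_local_layer: "filter (\<lambda>g. g = untargeted_gzz n \<alpha>) (local_layer U qs) = []"
  by (auto simp: local_layer_def untargeted_gzz_def filter_empty_conv)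

lemma gzz_count_rounds:
  "length (filter (\<lambda>g. g = untargeted_gzz n \<alpha>) (concat (map (\<lambda>b. signed_gzz n \<alpha> (x b)) bs))) = length bs"
  by (induction bs) (simp_all add: signed_gzz_def Let_def gzz_count_local_layer)

section \<open>Synthesis of a layer and of a whole circuit\<close>

lemma cnot_layer_synthesis:
  fixes n k :: nat
  defines "\<alpha> \<equiv> pi / 2 ^ (k + 1)"
  assumes k: "n \<le> Suc (2 ^ k)" and L: "cnot_layer n L"
  shows "\<exists>C'. (\<forall>g\<in>set C'. local_clifford_gate n g \<or> g = untargeted_gzz n \<alpha>) \<and>
    length (filter (\<lambda>g. g = untargeted_gzz n \<alpha>) C') \<le> 2 ^ k \<and> synthesises n C' L"
proof -
  obtain P where P: "L = cnots P" "distinct (touched P)" "set (touched P) \<subseteq> {..<n}"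
    using cnot_layer_cnots[OF L] .
  show ?thesis
  \<comment> \<open>Without a pair nothing can be contracted, and \<open>n = Suc (2 ^ k)\<close>
    qubits would need one row too many; the empty layer is synthesised by the empty circuit.\<close>
  proof (cases "P = []")
    case True
    then show ?thesis using P(1) by (intro exI[of _ "[]"]) (simp add: synthesises_Nil)
  next
    case False
    obtain f :: "nat \<Rightarrow> nat" where "\<forall>i<n. f i < 2 ^ k"
      and "\<forall>i<n. \<forall>j<n. i \<noteq> j \<longrightarrow> f i = f j \<longleftrightarrow> (i, j) \<in> set P \<or> (j, i) \<in> set P"
      using pair_labelling[OF P(2,3) False k] .
    then have f: "\<And>i. i < n \<Longrightarrow> f i < 2 ^ k"
      "\<And>i j. i < n \<Longrightarrow> j < n \<Longrightarrow> i \<noteq> j \<Longrightarrow> f i = f j \<longleftrightarrow> (i, j) \<in> set P \<or> (j, i) \<in> set P"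
      by simp_all
    define x where "x b q = sylvester k (f q) b" for b q
    have x: "x b q = 1 \<or> x b q = - 1" for b q unfolding x_def by (rule sylvester_cases)
    define G where "G = concat (map (\<lambda>b. signed_gzz n \<alpha> (x b)) [0..<2 ^ k])"
    define H where "H = local_layer hadamard (map snd P)"
    define C' where "C' = H @ local_layer sdg (touched P) @ G @ H"
    let ?A = "{(i, j). i < j \<and> j < n}"
    have T: "set (map snd P) \<subseteq> {..<n}" using targets_touched[of P] P(3) by blast
    \<comment> \<open>This fixes the gate angle: \<open>2 ^ k\<close> rounds at
      \<open>\<alpha> / 2 = pi / 2 ^ (k + 2)\<close> add up to \<open>pi / 4\<close> on each
      pair.\<close>
    have angle: "\<alpha> / 2 * (\<Sum>(i, j)\<in>?A. (\<Sum>b\<leftarrow>[0..<2 ^ k]. x b i * x b j) * (zval r i * zval r j)) =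
        pi / 4 * (\<Sum>(c, t)\<leftarrow>P. zval r c * zval r t)" for r
    proof -
      have "(\<Sum>(i, j)\<in>?A. (\<Sum>b\<leftarrow>[0..<2 ^ k]. x b i * x b j) * (zval r i * zval r j)) =
          (\<Sum>(i, j)\<in>?A. 2 ^ k * (if (i, j) \<in> set P \<or> (j, i) \<in> set P then zval r i * zval r j else 0))"
      proof (rule sum.cong[OF refl], clarify)
        fix i j assume ij: "i < j" "j < n"
        \<comment> \<open>Orthogonality of the rows \<open>f i\<close> and \<open>f j\<close>, which
          coincide exactly for paired qubits.\<close>
        have "(\<Sum>b\<leftarrow>[0..<2 ^ k]. x b i * x b j) = (if f i = f j then 2 ^ k else 0)"
          using sylvester_orthogonal[OF f(1) f(1), of i j] ij
          by (simp add: x_def sum_list_distinct_conv_sum_set lessThan_atLeast0)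
        then show "(\<Sum>b\<leftarrow>[0..<2 ^ k]. x b i * x b j) * (zval r i * zval r j) =
            2 ^ k * (if (i, j) \<in> set P \<or> (j, i) \<in> set P then zval r i * zval r j else 0)"
          using f(2)[of i j] ij by simp
      qed
      also have "\<dots> = 2 ^ k * (\<Sum>(c, t)\<leftarrow>P. zval r c * zval r t)"
        using sum_ordered_pairs[OF P(2,3), of "\<lambda>i j. zval r i * zval r j"]
        by (simp add: case_prod_unfold mult.commute flip: sum_distrib_left)
      finally show ?thesis by (simp add: \<alpha>_def)
    qed
    have G: "circuit_mat n G = mat_diag (2 ^ n) (\<lambda>r.
        exp (- \<i> * of_real (pi / 4 * (\<Sum>(c, t)\<leftarrow>P. zval r c * zval r t))))"
      unfolding G_def circuit_mat_signed_gzz_rounds[of x, OF x] by (simp only: angle)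
    let ?s = "pi / 4 * length P"
    let ?M = "circuit_mat n H"
    let ?D = "circuit_mat n G * circuit_mat n (local_layer sdg (touched P))"
    have "mat_diag (2 ^ n) (\<lambda>r. \<Prod>p\<leftarrow>P. cz r p) = cis ?s \<cdot>\<^sub>m ?D"
      unfolding G local_layer_sdg[OF P(3)] mat_diag_diag smult_mat_diag prod_cz_conv_zval
      by (simp only: mult_ac)
    then have "circuit_mat n L = ?M * (cis ?s \<cdot>\<^sub>m ?D) * ?M"
      unfolding P(1) circuit_mat_cnots[OF P(2,3)] H_def by simp
    also have "\<dots> = cis ?s \<cdot>\<^sub>m (?M * ?D * ?M)"
      by (simp add: mult_smult_distrib[of _ "2 ^ n" "2 ^ n" _ "2 ^ n"]
          mult_smult_assoc_mat[of _ "2 ^ n" "2 ^ n" _ "2 ^ n"] mult_carrier_mat[of _ "2 ^ n" "2 ^ n" _ "2 ^ n"])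
    also have "?M * ?D * ?M = circuit_mat n C'"
      unfolding C'_def circuit_mat_append
      by (simp add: assoc_mult_mat[of _ "2 ^ n" "2 ^ n" _ "2 ^ n" _ "2 ^ n"]
          mult_carrier_mat[of _ "2 ^ n" "2 ^ n" _ "2 ^ n"])
    \<comment> \<open>The phase is inverted because \<open>synthesises\<close> puts it on the side
      of the given circuit.\<close>
    finally have "cis (- ?s) \<cdot>\<^sub>m circuit_mat n L = circuit_mat n C'"
      by (simp add: smult_smult_mat cis_mult one_smult_mat)
    then have "synthesises n C' L" unfolding synthesises_def by metis
    moreover have "\<forall>g\<in>set C'. local_clifford_gate n g \<or> g = untargeted_gzz n \<alpha>"
      unfolding C'_def G_def H_def
      using local_layer_gates[OF local_clifford_hadamard T] local_layer_gates[OF local_clifford_sdg P(3)]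
        signed_gzz_gates[of _ n \<alpha>] by fastforce
    moreover have "length (filter (\<lambda>g. g = untargeted_gzz n \<alpha>) C') \<le> 2 ^ k"
      unfolding C'_def H_def G_def by (simp add: gzz_count_local_layer gzz_count_rounds)
    ultimately show ?thesis by blast
  qed
qed

theorem proposition5p2:
  fixes n d k :: nat and C :: circuit
  assumes "k = (LEAST m::nat. int n - 1 \<le> 2 ^ m)"
    and "cnot_circuit n d C"
  shows "\<exists>C'. (\<forall>g\<in>set C'. local_clifford_gate n g \<or> g = untargeted_gzz n (pi / 2 ^ (k + 1)))
      \<and> length (filter (\<lambda>g. g = untargeted_gzz n (pi / 2 ^ (k + 1))) C') \<le> d * 2 ^ k
      \<and> synthesises n C' C"
proof -
  \<comment> \<open>The exponent \<open>n\<close> is admissible, so the least one exists and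
    satisfies the bound; rewriting it with \<open>Suc\<close> avoids truncated subtraction at
    \<open>n = 0\<close>.\<close>
  have "int n - 1 \<le> 2 ^ n" using of_nat_less_two_power[of n] by (smt (verit))
  then have "int n - 1 \<le> 2 ^ k" unfolding assms(1) by (rule LeastI)
  then have "int n \<le> int (Suc (2 ^ k))" by simp
  then have k: "n \<le> Suc (2 ^ k)" by (simp only: of_nat_le_iff)
  obtain Ls where Ls: "length Ls = d" "\<forall>L\<in>set Ls. cnot_layer n L" "C = concat Ls"
    using assms(2) unfolding cnot_circuit_def by blast
  show ?thesis
    using Ls
  proof (induction Ls arbitrary: d C)
    case Nil
    then show ?case by (intro exI[of _ "[]"]) (simp add: synthesises_Nil)
  next
    case (Cons L Ls)
    obtain D where D: "\<forall>g\<in>set D. local_clifford_gate n g \<or> g = untargeted_gzz n (pi / 2 ^ (k + 1))"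
      "length (filter (\<lambda>g. g = untargeted_gzz n (pi / 2 ^ (k + 1))) D) \<le> 2 ^ k" "synthesises n D L"
      using cnot_layer_synthesis[OF k, of L] Cons.prems(2) by auto
    \<comment> \<open>The remaining layers number \<open>length Ls\<close>, one less than
      \<open>d\<close>, which leaves room for the \<open>2 ^ k\<close> gates of
      \<open>D\<close>.\<close>
    obtain E where E: "\<forall>g\<in>set E. local_clifford_gate n g \<or> g = untargeted_gzz n (pi / 2 ^ (k + 1))"
      "length (filter (\<lambda>g. g = untargeted_gzz n (pi / 2 ^ (k + 1))) E) \<le> length Ls * 2 ^ k"
      "synthesises n E (concat Ls)"
      using Cons.IH[of "length Ls" "concat Ls"] Cons.prems(2) by auto
    have "synthesises n (D @ E) C"
      using synthesises_append[OF D(3) E(3)] Cons.prems(3) by simp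
    moreover have "length (filter (\<lambda>g. g = untargeted_gzz n (pi / 2 ^ (k + 1))) (D @ E)) \<le> d * 2 ^ k"
      using D(2) E(2) Cons.prems(1) by auto
    moreover have "\<forall>g\<in>set (D @ E). local_clifford_gate n g \<or> g = untargeted_gzz n (pi / 2 ^ (k + 1))"
      using D(1) E(1) by auto
    ultimately show ?case by blast
  qed
qed

end
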